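(* Let $\nu,N,m,\ell,n\in\mathbb{N}$, let $\mathbb{P}\subseteq\mathbb{C}^\nu$ be a compact set, and let $E,A\colon\mathbb{P}\to\mathbb{C}^{N\times N}$, $B\colon\mathbb{P}\to\mathbb{C}^{N\times m}$, $C\colon\mathbb{P}\to\mathbb{C}^{\ell\times N}$ be holomorphic in $\mathbb{P}$, with $E(p)$ nonsingular for every $p\in\mathbb{P}$. Assume that for $i=1,\ldots,n$ the functions $\lambda_i,\mu_i\colon\mathbb{P}\to\mathbb{C}$ are holomorphic and satisfy $$\lambda_i(p),\ \mu_i(p)\notin\sigma(E(p),A(p))\qquad\text{for all } p\in\mathbb{P}.$$ If the tangent directions $r_i\colon\mathbb{P}\to\mathbb{C}^m$ and $\ell_i\colon\mathbb{P}\to\mathbb{C}^\ell$ ($i=1,\ldots,n$) are holomorphic, then there exist holomorphic functions $V,W\colon\mathbb{P}\to\mathbb{C}^{N\times n}$ satisfying $$A(p)V(p)-E(p)V(p)\Lambda(p)+B(p)R(p)=0,$$ $$W(p)^\top A(p)-M(p)^\top W(p)^\top E(p)+L(p)^\top C(p)=0$$ for all $p\in\mathbb{P}$.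
   Context: The matrix functions $E,A,B,C$ define the parametric linear dynamical system $E(p)\dot x(t;p)=A(p)x(t;p)+B(p)u(t)$, $y(t;p)=C(p)x(t;p)$, $x(0;p)=0$. The spectrum of the matrix pencil $sE(p)-A(p)$ is $\sigma(E(p),A(p))=\{s\in\mathbb{C}\mid \operatorname{rank}(sE(p)-A(p))<N\}$. The matrix functions $\Lambda,M\colon\mathbb{P}\to\mathbb{C}^{n\times n}$, $R\colon\mathbb{P}\to\mathbb{C}^{m\times n}$, $L\colon\mathbb{P}\to\mathbb{C}^{\ell\times n}$ are defined by $$\Lambda(p)=\operatorname{diag}(\lambda_1(p),\ldots,\lambda_n(p)),\quad M(p)=\operatorname{diag}(\mu_1(p),\ldots,\mu_n(p)),$$ $$R(p)=\begin{bmatrix} r_1(p)&\cdots&r_n(p)\end{bmatrix},\quad L(p)=\begin{bmatrix}\ell_1(p)&\cdots&\ell_n(p)\end{bmatrix}.$$ The superscript $\top$ is the plain transpose (no complex conjugation). A scalar function of several complex variables is holomorphic at $p$ if $\lim_{h\to0}(f(p+hq)-f(p))/h$ (with $h\in\mathbb{C}$) exists for every $q\in\mathbb{C}^\nu$; vector- and matrix-valued functions are holomorphic if all entries are. A function on the compact set $\mathbb{P}$ is called holomorphic in $\mathbb{P}$ if it is the restriction to $\mathbb{P}$ of a function holomorphic on an open neighborhood of $\mathbb{P}$ in $\mathbb{C}^\nu$. *)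

theory Defs
  imports "HOL-Analysis.Analysis"
begin

text \<open>
  Holomorphy in several complex variables: existence of the complex directional derivative
  in every direction. No continuity or joint differentiability is part of the definition.
\<close>

definition mv_holomorphic_at :: "(complex^'nu \<Rightarrow> complex) \<Rightarrow> complex^'nu \<Rightarrow> bool" where
  "mv_holomorphic_at f p \<longleftrightarrow>
     (\<forall>q. \<exists>D. ((\<lambda>h::complex. (f (p + h *s q) - f p) / h) \<longlongrightarrow> D) (at 0))"

text \<open>
  Functions on \<open>P\<close> are represented by total functions whose values outside \<open>P\<close> are
  irrelevant; hence the extension \<open>g\<close> need not agree with \<open>f\<close> off \<open>P\<close>.
\<close>

definition holomorphic_in :: "(complex^'nu \<Rightarrow> complex) \<Rightarrow> (complex^'nu) set \<Rightarrow> bool" where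
  "holomorphic_in f P \<longleftrightarrow>
     (\<exists>U g. open U \<and> P \<subseteq> U \<and> (\<forall>p\<in>U. mv_holomorphic_at g p) \<and> (\<forall>p\<in>P. g p = f p))"

definition vec_holomorphic_in ::
    "(complex^'nu \<Rightarrow> complex^'k) \<Rightarrow> (complex^'nu) set \<Rightarrow> bool" where
  "vec_holomorphic_in f P \<longleftrightarrow> (\<forall>i. holomorphic_in (\<lambda>p. f p $ i) P)"

definition mat_holomorphic_in ::
    "(complex^'nu \<Rightarrow> complex^'k^'j) \<Rightarrow> (complex^'nu) set \<Rightarrow> bool" where
  "mat_holomorphic_in F P \<longleftrightarrow> (\<forall>i j. holomorphic_in (\<lambda>p. F p $ i $ j) P)"

definition pencil_spectrum :: "complex^'N^'N \<Rightarrow> complex^'N^'N \<Rightarrow> complex set" where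
  "pencil_spectrum E A = {s. rank (map_matrix (\<lambda>z. s * z) E - A) < CARD('N)}"

definition diag_matrix :: "('n \<Rightarrow> complex) \<Rightarrow> complex^'n^'n" where
  "diag_matrix d = (\<chi> i j. if i = j then d i else 0)"

definition matrix_of_columns :: "('n \<Rightarrow> complex^'k) \<Rightarrow> complex^'n^'k" where
  "matrix_of_columns c = (\<chi> i j. c j $ i)"

end

theory Submission
  imports Defs "HOL-Complex_Analysis.Cauchy_Integral_Formula"
begin

text \<open>
  The two matrix equations decouple into their columns. The \<open>i\<close>-th column of the first one is the
  linear system \<open>(\<lambda>\<^sub>i(p) E(p) - A(p)) v\<^sub>i(p) = B(p) r\<^sub>i(p)\<close>, whose matrix has nonzero determinant
  for \<open>p \<in> P\<close> because \<open>\<lambda>\<^sub>i(p)\<close> lies outside the spectrum of the pencil; the second one is, after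
  transposition, a system of the same kind. By Cramer's rule the entries of the solution are
  quotients of polynomials in holomorphic functions.

  What has to be shown is that such a quotient is again holomorphic on a neighbourhood of \<open>P\<close>: the
  determinant of the extended coefficients is nonzero on \<open>P\<close>, and one needs that it stays nonzero
  nearby, i.e. that it is continuous. Holomorphy here means only holomorphy along every complex
  line, so that continuity (\<open>mv_holomorphic_imp_continuous_on\<close>) is a theorem of Hartogs type. Since
  all complex lines are available, and not just those parallel to the axes, it follows from the
  Baire category theorem and the maximum principle:

  By the Cauchy estimates, a function that is holomorphic along lines and bounded near a point is
  continuous there, so it suffices to prove local boundedness. This is done by induction on the
  number of coordinates that are allowed to vary. Given a point \<open>a\<close> and a new coordinate vector
  \<open>e\<close>, consider the lines \<open>z \<mapsto> a + z (e + \<theta>)\<close> through \<open>a\<close>, where \<open>\<theta>\<close> ranges over the unit ball of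
  the old coordinate subspace. On each of these lines the function is bounded for \<open>\<bar>z\<bar> \<le> \<rho>\<close>, and for
  each fixed \<open>z\<close> it is continuous in \<open>\<theta>\<close> by the induction hypothesis. By Baire's theorem there is one
  bound valid for all \<open>\<theta>\<close> in some ball around a direction \<open>\<theta>\<^sub>0\<close>. The circle
  \<open>{a + z (e + \<theta>\<^sub>0). \<bar>z\<bar> = \<rho>/2}\<close> then has a neighbourhood on which the function is bounded, and the
  maximum principle on the translates of this circle gives the same bound near its centre \<open>a\<close>.
\<close>

section \<open>Holomorphy along complex lines\<close>

lemma norm_smult_complex: "norm (c *s (x::complex^'k)) = cmod c * norm x"
  by (simp add: norm_vec_def L2_set_right_distrib norm_mult)

lemma mv_holomorphic_at_iff_line:
  "mv_holomorphic_at f p \<longleftrightarrow> (\<forall>q. (\<lambda>h. f (p + h *s q)) field_differentiable (at 0))"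
  by (simp add: mv_holomorphic_at_def field_differentiable_def has_field_derivative_iff)

lemma holomorphic_on_line:
  assumes f: "\<And>p. p \<in> U \<Longrightarrow> mv_holomorphic_at f p"
    and T: "\<And>z. z \<in> T \<Longrightarrow> a + z *s q \<in> U"
  shows "(\<lambda>z. f (a + z *s q)) holomorphic_on T"
  unfolding holomorphic_on_def
proof
  fix z assume z: "z \<in> T"
  have "(\<lambda>h. f ((a + z *s q) + h *s q)) field_differentiable (at (z - z))"
    using f[OF T[OF z]] by (simp add: mv_holomorphic_at_iff_line)
  moreover have "(\<lambda>w. w - z) field_differentiable (at z)"
    by (intro derivative_intros)
  ultimately have "((\<lambda>h. f ((a + z *s q) + h *s q)) \<circ> (\<lambda>w. w - z)) field_differentiable (at z)"
    by (intro field_differentiable_compose)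
  moreover have "a + z *s q + (w - z) *s q = a + w *s q" for w
    by (simp add: vector_sub_rdistrib)
  ultimately show "(\<lambda>z. f (a + z *s q)) field_differentiable (at z within T)"
    by (simp add: o_def field_differentiable_at_within)
qed

text \<open>
  A Cauchy estimate, applied on discs of radius \<open>r/2\<close> about the points of the unit disc.
\<close>

lemma bounded_holomorphic_difference:
  assumes holu: "u holomorphic_on ball 0 r" and "2 < r"
    and bound: "\<And>z. z \<in> ball 0 r \<Longrightarrow> cmod (u z) \<le> M"
  shows "cmod (u 1 - u 0) \<le> 2 * M / r"
proof -
  have sub: "cball w (r/2) \<subseteq> ball 0 r" if "w \<in> cball 0 1" for w :: complex
  proof
    fix x assume "x \<in> cball w (r/2)"
    then have "cmod (x - w) \<le> r/2" by (simp add: dist_norm norm_minus_commute)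
    moreover have "cmod w \<le> 1" using that by simp
    moreover have "cmod x \<le> cmod (x - w) + cmod w"
      by (metis diff_add_cancel norm_triangle_ineq)
    ultimately show "x \<in> ball 0 r" using \<open>2 < r\<close> by simp
  qed
  have "cmod (u 1 - u 0) \<le> (2 * M / r) * cmod (1 - 0)"
  proof (rule field_differentiable_bound)
    show "convex (cball (0::complex) 1)" by simp
    fix w :: complex assume w: "w \<in> cball 0 1"
    have "w \<in> ball 0 r" using w \<open>2 < r\<close> by simp
    then show "(u has_field_derivative deriv u w) (at w within cball 0 1)"
      using holu by (meson has_field_derivative_at_within holomorphic_derivI open_ball)
    have "cmod ((deriv ^^ 1) u w) \<le> (fact 1) * M / (r/2)^1"
    proof (rule Cauchy_inequality)
      show "u holomorphic_on ball w (r/2)"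
        using holu sub[OF w] ball_subset_cball by (meson holomorphic_on_subset order_trans)
      show "continuous_on (cball w (r/2)) u"
        using holu sub[OF w] by (meson holomorphic_on_subset holomorphic_on_imp_continuous_on)
      show "0 < r/2" using \<open>2 < r\<close> by simp
      show "cmod (u x) \<le> M" if "cmod (w - x) = r/2" for x
        using that sub[OF w] by (intro bound) (auto simp: dist_norm)
    qed
    then show "cmod (deriv u w) \<le> 2 * M / r" by (simp add: mult.commute)
  qed auto
  then show ?thesis by simp
qed

section \<open>Local boundedness and continuity\<close>

text \<open>
  The subspace spanned by the coordinate vectors with index in \<open>I\<close>. Inductions on the dimension run
  over \<open>I\<close>, because the dimension of the ambient space is fixed by its type.
\<close>

definition coord_subspace :: "'k set \<Rightarrow> (complex^'k) set" where
  "coord_subspace I = {x. \<forall>i. i \<notin> I \<longrightarrow> x $ i = 0}"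

lemma coord_subspace_add: "x \<in> coord_subspace I \<Longrightarrow> y \<in> coord_subspace I \<Longrightarrow> x + y \<in> coord_subspace I"
  and coord_subspace_diff: "x \<in> coord_subspace I \<Longrightarrow> y \<in> coord_subspace I \<Longrightarrow> x - y \<in> coord_subspace I"
  and coord_subspace_smult: "x \<in> coord_subspace I \<Longrightarrow> c *s x \<in> coord_subspace I"
  and coord_subspace_zero: "0 \<in> coord_subspace I"
  by (auto simp: coord_subspace_def)

lemma closed_coord_subspace: "closed (coord_subspace I)"
  unfolding coord_subspace_def by (intro closed_Collect_all closed_Collect_imp closed_Collect_eq
    open_Collect_const continuous_intros)

text \<open>
  If \<open>f\<close> is bounded by \<open>M\<close> on the ball of radius \<open>r\<close> about \<open>a\<close>, the Cauchy estimate on the line through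
  \<open>a\<close> and \<open>x\<close> gives \<open>\<bar>f(x) - f(a)\<bar> \<le> 2 M \<bar>x - a\<bar> / r\<close> whenever \<open>\<bar>x - a\<bar> < r/2\<close>; only points of the affine
  coordinate subspace through \<open>a\<close> are involved.
\<close>

lemma continuous_within_if_bounded:
  assumes f: "\<And>p. p \<in> U \<Longrightarrow> mv_holomorphic_at f p"
    and r: "0 < r" "ball a r \<subseteq> U"
    and M: "\<And>x. x \<in> ball a r \<Longrightarrow> x - a \<in> coord_subspace I \<Longrightarrow> cmod (f x) \<le> M"
  shows "continuous (at a within {x. x - a \<in> coord_subspace I}) f"
proof -
  have est: "cmod (f x - f a) \<le> (2 * M / r) * dist x a"
    if x: "x - a \<in> coord_subspace I" and xa: "dist x a < r / 2" for x
  proof (cases "x = a")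
    case False
    define q where "q = x - a"
    define s where "s = r / norm q"
    have q: "0 < norm q" "norm q < r/2" using False xa by (auto simp: q_def dist_norm)
    have s: "2 < s" using q by (simp add: s_def field_simps)
    have inb: "a + z *s q \<in> ball a r" if "z \<in> ball 0 s" for z
      using that q by (simp add: dist_norm norm_smult_complex s_def field_simps)
    have "cmod (f (a + 1 *s q) - f (a + 0 *s q)) \<le> 2 * M / s"
    proof (rule bounded_holomorphic_difference[OF _ s])
      show "(\<lambda>z. f (a + z *s q)) holomorphic_on ball 0 s"
        using inb r by (intro holomorphic_on_line[OF f]) auto
      show "cmod (f (a + z *s q)) \<le> M" if "z \<in> ball 0 s" for z
        using x by (intro M inb that) (simp add: q_def coord_subspace_smult del: vector_ssub_ldistrib)
    qed
    then show ?thesis by (simp add: q_def s_def dist_norm)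
  qed simp
  have "((\<lambda>x. f x - f a) \<longlongrightarrow> 0) (at a within {x. x - a \<in> coord_subspace I})"
  proof (rule Lim_null_comparison)
    show "\<forall>\<^sub>F x in at a within {x. x - a \<in> coord_subspace I}.
            norm (f x - f a) \<le> (2 * M / r) * dist x a"
      unfolding eventually_at using est \<open>0 < r\<close> by (intro exI[of _ "r/2"]) auto
    have "((\<lambda>x. (2 * M / r) * dist x a) \<longlongrightarrow> (2 * M / r) * dist a a)
             (at a within {x. x - a \<in> coord_subspace I})"
      by (intro tendsto_intros)
    then show "((\<lambda>x. (2 * M / r) * dist x a) \<longlongrightarrow> 0) (at a within {x. x - a \<in> coord_subspace I})"
      by simp
  qed
  then show ?thesis
    unfolding continuous_within by (rule LIM_zero_cancel)
qed

text \<open>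
  Baire's theorem for covers: one of countably many closed sets covering \<open>S\<close> has interior relative
  to \<open>S\<close>.
\<close>

lemma Baire_closed_cover:
  fixes S :: "'a::{real_normed_vector,heine_borel} set" and F :: "nat \<Rightarrow> 'a set"
  assumes "closed S" "S \<noteq> {}" and F: "\<And>k. closed (F k)" and cover: "S \<subseteq> (\<Union>k. F k)"
  obtains x e k where "x \<in> S" "0 < e" "ball x e \<inter> S \<subseteq> F k"
proof -
  have "\<exists>k. \<not> S \<subseteq> closure (S - F k)"
  proof (rule ccontr)
    assume "\<not> ?thesis"
    then have "S \<subseteq> closure (\<Inter>(range (\<lambda>k. S - F k)))"
      using F by (intro Baire \<open>closed S\<close>) (auto simp: openin_closedin_eq closedin_closed Diff_Diff_Int)
    moreover have "\<Inter>(range (\<lambda>k. S - F k)) = {}" using cover by auto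
    ultimately show False using \<open>S \<noteq> {}\<close> by (metis closure_empty subset_empty)
  qed
  then obtain k x where "x \<in> S" "x \<notin> closure (S - F k)" by auto
  then obtain e where "0 < e" "\<forall>y\<in>S - F k. \<not> dist y x < e"
    by (auto simp: closure_approachable)
  then show ?thesis
    using \<open>x \<in> S\<close> by (intro that[of x e k]) (auto simp: dist_commute)
qed


lemma continuous_on_smult [continuous_intros]:
  "continuous_on A g \<Longrightarrow> continuous_on A (\<lambda>x. c *s (g x :: complex^'k))"
  unfolding vector_scalar_mult_def by (intro continuous_intros)

text \<open>
  The induction step carries the argument: it passes from the coordinates in \<open>I\<close> to those in
  \<open>insert j I\<close> by means of the lines through \<open>a\<close> in the directions \<open>e + \<theta>\<close>, where \<open>e\<close> is the \<open>j\<close>-th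
  coordinate vector and \<open>\<theta>\<close> lies in \<open>coord_subspace I\<close>.
\<close>

lemma locally_bounded_coord:
  fixes f :: "complex^'k \<Rightarrow> complex"
  assumes f: "\<And>p. p \<in> U \<Longrightarrow> mv_holomorphic_at f p" and "open U" and "finite I" and "a \<in> U"
  shows "\<exists>r>0. \<exists>M. ball a r \<subseteq> U \<and>
           (\<forall>x\<in>ball a r. x - a \<in> coord_subspace I \<longrightarrow> cmod (f x) \<le> M)"
  using \<open>finite I\<close> \<open>a \<in> U\<close>
proof (induction I arbitrary: a)
  case empty
  obtain r where "0 < r" "ball a r \<subseteq> U"
    using \<open>open U\<close> empty by (auto elim: openE)
  moreover have "x = a" if "x - a \<in> coord_subspace {}" for x
    using that by (simp add: coord_subspace_def vec_eq_iff)
  ultimately show ?case by (intro exI[of _ r] exI[of _ "cmod (f a)"]) auto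
next
  case (insert j I)
  define e :: "complex^'k" where "e = axis j 1"
  have norm_e: "norm e = 1" by (simp add: e_def)
  obtain \<rho>0 where \<rho>0: "0 < \<rho>0" "cball a \<rho>0 \<subseteq> U"
    using \<open>open U\<close> insert.prems open_contains_cball by blast
  define \<rho> where "\<rho> = \<rho>0 / 4"
  have \<rho>: "0 < \<rho>" using \<rho>0 by (simp add: \<rho>_def)
  define K where "K = coord_subspace I \<inter> cball 0 1"
  have K_zero: "0 \<in> K" by (simp add: K_def coord_subspace_zero)
  have closed_K: "closed K" by (simp add: K_def closed_Int closed_coord_subspace)
  have norm_e_add: "norm (e + \<theta>) \<le> 2" if "\<theta> \<in> K" for \<theta>
    using norm_triangle_ineq[of e \<theta>] that norm_e by (auto simp: K_def)
  have in_U: "a + g + z *s (e + \<theta>) \<in> U"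
    if "\<theta> \<in> K" "cmod z \<le> \<rho>" "norm g \<le> \<rho>" for \<theta> z g
  proof -
    have "norm (z *s (e + \<theta>)) \<le> \<rho> * 2"
      unfolding norm_smult_complex using that norm_e_add \<rho> by (intro mult_mono) auto
    then have "norm (g + z *s (e + \<theta>)) \<le> \<rho>0"
      using norm_triangle_ineq[of g "z *s (e + \<theta>)"] that \<rho> by (simp add: \<rho>_def)
    then show ?thesis
      using \<rho>0(2) by (auto simp: subset_iff dist_norm norm_minus_commute add.assoc)
  qed
  have in_U0: "a + z *s (e + \<theta>) \<in> U" if "\<theta> \<in> K" "cmod z \<le> \<rho>" for \<theta> z
    using in_U[OF that, of 0] \<rho> by simp
  define F where "F = (\<lambda>k::nat. {\<theta> \<in> K. \<forall>z\<in>cball 0 \<rho>. cmod (f (a + z *s (e + \<theta>))) \<le> real k})"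
  \<comment> \<open>For fixed \<open>z\<close>, the point \<open>a + z (e + \<theta>)\<close> moves parallel to \<open>coord_subspace I\<close> as \<open>\<theta>\<close> varies, so
      the induction hypothesis at \<open>a + z (e + \<theta>)\<close> applies.\<close>
  have cont: "continuous_on K (\<lambda>\<theta>. f (a + z *s (e + \<theta>)))" if z: "cmod z \<le> \<rho>" for z
    unfolding continuous_on_eq_continuous_within
  proof
    fix \<theta> assume \<theta>: "\<theta> \<in> K"
    define b where "b = a + z *s (e + \<theta>)"
    have "b \<in> U" using in_U0[OF \<theta> z] by (simp add: b_def)
    then obtain r M where "0 < r" "ball b r \<subseteq> U"
      "\<And>x. x \<in> ball b r \<Longrightarrow> x - b \<in> coord_subspace I \<Longrightarrow> cmod (f x) \<le> M"
      using insert.IH by metis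
    then have "continuous (at b within {x. x - b \<in> coord_subspace I}) f"
      by (intro continuous_within_if_bounded[OF f])
    moreover have "(\<lambda>\<theta>. a + z *s (e + \<theta>)) ` K \<subseteq> {x. x - b \<in> coord_subspace I}"
    proof clarify
      fix \<theta>' assume "\<theta>' \<in> K"
      moreover have "a + z *s (e + \<theta>') - b = z *s (\<theta>' - \<theta>)"
        by (simp add: b_def vec_eq_iff algebra_simps)
      ultimately show "a + z *s (e + \<theta>') - b \<in> coord_subspace I"
        using \<theta> by (auto simp only: K_def intro!: coord_subspace_smult coord_subspace_diff)
    qed
    ultimately have "continuous (at b within (\<lambda>\<theta>. a + z *s (e + \<theta>)) ` K) f"
      by (rule continuous_within_subset)
    moreover have "continuous_on K (\<lambda>\<theta>. a + z *s (e + \<theta>))"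
      by (intro continuous_intros)
    then have "continuous (at \<theta> within K) (\<lambda>\<theta>. a + z *s (e + \<theta>))"
      using \<theta> by (simp add: continuous_on_eq_continuous_within)
    ultimately show "continuous (at \<theta> within K) (\<lambda>\<theta>. f (a + z *s (e + \<theta>)))"
      unfolding b_def using continuous_within_compose2 by fastforce
  qed
  have closed_F: "closed (F k)" for k
  proof -
    have "(0::complex) \<in> cball 0 \<rho>" using \<rho> by simp
    then have "F k = (\<Inter>z\<in>cball 0 \<rho>. {\<theta> \<in> K. cmod (f (a + z *s (e + \<theta>))) \<le> real k})"
      unfolding F_def by blast
    moreover have "closed {\<theta> \<in> K. cmod (f (a + z *s (e + \<theta>))) \<le> real k}" if "z \<in> cball 0 \<rho>" for z
      using that closed_K
      by (intro continuous_on_closed_Collect_le continuous_on_norm cont continuous_on_const) auto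
    ultimately show ?thesis by (auto intro!: closed_INT)
  qed
  have cover: "K \<subseteq> (\<Union>k. F k)"
  proof
    fix \<theta> assume \<theta>: "\<theta> \<in> K"
    have "(\<lambda>z. f (a + z *s (e + \<theta>))) holomorphic_on cball 0 \<rho>"
      using in_U0 \<theta> by (intro holomorphic_on_line[OF f]) auto
    then have "bounded ((\<lambda>z. f (a + z *s (e + \<theta>))) ` cball 0 \<rho>)"
      by (rule compact_imp_bounded[OF compact_continuous_image[OF
            holomorphic_on_imp_continuous_on compact_cball]])
    then obtain B where B: "\<And>z. z \<in> cball 0 \<rho> \<Longrightarrow> cmod (f (a + z *s (e + \<theta>))) \<le> B"
      unfolding bounded_iff by blast
    obtain k :: nat where "B \<le> real k" using real_arch_simple by blast
    then have "\<theta> \<in> F k"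
      unfolding F_def using \<theta> order_trans[OF B] by blast
    then show "\<theta> \<in> (\<Union>k. F k)" by blast
  qed
  have "K \<noteq> {}" using K_zero by blast
  then obtain x \<epsilon> k where x: "x \<in> K" "0 < \<epsilon>" "ball x \<epsilon> \<inter> K \<subseteq> F k"
    using Baire_closed_cover[OF closed_K _ closed_F cover] by metis
  \<comment> \<open>The point \<open>x\<close> may lie on the unit sphere; moving it towards the origin gives a direction \<open>\<theta>0\<close>
      for which the whole ball of radius \<open>t\<close> in \<open>coord_subspace I\<close> is contained in \<open>F k\<close>.\<close>
  define t where "t = min (\<epsilon> / 3) (1 / 2)"
  have t: "0 < t" "2 * t < \<epsilon>" "t \<le> 1/2" using \<open>0 < \<epsilon>\<close> by (auto simp: t_def min_def)
  define \<theta>0 where "\<theta>0 = (1 - complex_of_real t) *s x"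
  have norm_x: "norm x \<le> 1" and x_I: "x \<in> coord_subspace I" using x by (auto simp: K_def)
  have "cmod (1 - complex_of_real t) = 1 - t"
    using t norm_of_real[of "1 - t", where 'a = complex] by simp
  then have "norm \<theta>0 = (1 - t) * norm x"
    unfolding \<theta>0_def norm_smult_complex by simp
  then have norm_\<theta>0: "norm \<theta>0 \<le> 1 - t"
    using norm_x t by (simp add: mult_left_le)
  have \<theta>0_I: "\<theta>0 \<in> coord_subspace I" 
    unfolding \<theta>0_def using x_I by (rule coord_subspace_smult)
  have \<theta>0_K: "\<theta>0 \<in> K" using norm_\<theta>0 t \<theta>0_I by (simp add: K_def)
  have near: "\<theta> \<in> F k" if "\<theta> \<in> coord_subspace I" "norm (\<theta> - \<theta>0) < t" for \<theta>
  proof -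
    have "x - \<theta>0 = complex_of_real t *s x"
      by (simp add: \<theta>0_def vec_eq_iff algebra_simps)
    then have "norm (x - \<theta>0) \<le> t"
      using norm_x t by (simp add: norm_smult_complex mult_left_le)
    then have "norm (x - \<theta>) < \<epsilon>"
      using that t norm_triangle_ineq[of "x - \<theta>0" "\<theta>0 - \<theta>"] by (simp add: norm_minus_commute)
    moreover have "norm \<theta> \<le> 1"
      using that norm_\<theta>0 norm_triangle_ineq[of "\<theta> - \<theta>0" \<theta>0] by simp
    ultimately show ?thesis using x(3) that by (auto simp: K_def dist_norm)
  qed
  define r where "r = \<rho> * t / 12"
  have "\<rho> * t \<le> \<rho> * (1/2)" using t \<rho> by (intro mult_left_mono) auto
  then have r: "0 < r" "r \<le> \<rho> / 24" using \<rho> t by (auto simp: r_def)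
  have bound: "cmod (f (a + g)) \<le> real k"
    if g: "g \<in> coord_subspace (insert j I)" "norm g < r" for g
  proof -
    have gj: "cmod (g $ j) \<le> norm g" by (rule Finite_Cartesian_Product.norm_nth_le)
    have hol: "(\<lambda>z. f (a + g + z *s (e + \<theta>0))) holomorphic_on cball 0 (\<rho>/2)"
    proof (rule holomorphic_on_line[OF f])
      fix z assume "z \<in> cball (0::complex) (\<rho>/2)"
      then have "cmod z \<le> \<rho>" "norm g \<le> \<rho>" using g r \<rho> by auto
      then show "a + g + z *s (e + \<theta>0) \<in> U" by (rule in_U[OF \<theta>0_K])
    qed
    \<comment> \<open>A point of the translated circle lies on the line through \<open>a\<close> in a direction \<open>e + \<theta>\<close> with \<open>\<theta>\<close>
        close to \<open>\<theta>0\<close>; the parameter \<open>w\<close> on that line is read off from the \<open>j\<close>-th coordinate.\<close>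
    have circle: "cmod (f (a + g + z *s (e + \<theta>0))) \<le> real k" if z: "cmod z = \<rho>/2" for z
    proof -
      define w where "w = z + g $ j"
      have w: "\<rho>/4 \<le> cmod w" "cmod w \<le> \<rho>"
        using norm_triangle_ineq[of z "g $ j"] norm_diff_ineq[of z "g $ j"] z gj g r \<rho>
        by (auto simp: w_def)
      define \<theta> where "\<theta> = (1/w) *s (z *s \<theta>0 + (g - (g $ j) *s e))"
      have w0: "w \<noteq> 0" using w \<rho> by auto
      have w\<theta>: "w *s \<theta> = z *s \<theta>0 + (g - (g $ j) *s e)"
        using w0 by (simp add: \<theta>_def vector_smult_assoc)
      have eq: "a + g + z *s (e + \<theta>0) = a + w *s (e + \<theta>)"
        unfolding vector_add_ldistrib w\<theta> by (simp add: vec_eq_iff w_def algebra_simps)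
      have g': "g - (g $ j) *s e \<in> coord_subspace I"
        using g by (auto simp: coord_subspace_def e_def axis_def)
      have "w *s (\<theta> - \<theta>0) = g - (g $ j) *s (e + \<theta>0)"
        unfolding vector_ssub_ldistrib w\<theta> by (simp add: vec_eq_iff w_def algebra_simps)
      then have "cmod w * norm (\<theta> - \<theta>0) = norm (g - (g $ j) *s (e + \<theta>0))"
        by (metis norm_smult_complex)
      then have "norm (\<theta> - \<theta>0) = norm (g - (g $ j) *s (e + \<theta>0)) / cmod w"
        using w0 by (simp add: nonzero_eq_divide_eq mult.commute)
      also have "norm (g - (g $ j) *s (e + \<theta>0)) \<le> norm g + norm g * 2"
        using norm_triangle_ineq4[of g "(g $ j) *s (e + \<theta>0)"]
          mult_mono[OF gj norm_e_add[OF \<theta>0_K]]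
        by (simp add: norm_smult_complex del: vector_add_ldistrib)
      then have "norm (g - (g $ j) *s (e + \<theta>0)) / cmod w \<le> (norm g * 3) / (\<rho>/4)"
        using w \<rho> by (intro frac_le) auto
      also have "\<dots> < t" using g \<rho> by (simp add: r_def field_simps)
      finally have "\<theta> \<in> F k"
        unfolding \<theta>_def using \<theta>0_I g'
        by (intro near coord_subspace_smult coord_subspace_add) (simp_all only: \<theta>_def)
      then show ?thesis
        unfolding eq using w by (simp add: F_def del: vector_add_ldistrib)
    qed
    \<comment> \<open>The Cauchy inequality of order \<open>0\<close> is the maximum principle at the centre of the disc.\<close>
    have "cmod ((deriv ^^ 0) (\<lambda>z. f (a + g + z *s (e + \<theta>0))) 0) \<le> fact 0 * real k / (\<rho>/2) ^ 0"
    proof (rule Cauchy_inequality)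
      show "(\<lambda>z. f (a + g + z *s (e + \<theta>0))) holomorphic_on ball 0 (\<rho>/2)"
        using hol ball_subset_cball holomorphic_on_subset by blast
    qed (use hol circle \<rho> in \<open>auto intro: holomorphic_on_imp_continuous_on\<close>)
    then show ?thesis by simp
  qed
  show ?case
  proof (intro exI conjI ballI impI)
    show "0 < r" by (rule r)
    show "ball a r \<subseteq> U" using \<rho>0 r by (auto simp: \<rho>_def subset_iff)
    fix x assume "x \<in> ball a r" "x - a \<in> coord_subspace (insert j I)"
    then show "cmod (f x) \<le> real k"
      using bound[of "x - a"] by (simp add: dist_norm norm_minus_commute)
  qed
qed

text \<open>
  Holomorphy along all complex lines implies joint continuity.
\<close>

theorem mv_holomorphic_imp_continuous_on:
  fixes f :: "complex^'k \<Rightarrow> complex"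
  assumes "open U" and f: "\<And>p. p \<in> U \<Longrightarrow> mv_holomorphic_at f p"
  shows "continuous_on U f"
proof -
  have "isCont f a" if a: "a \<in> U" for a
  proof -
    have "\<exists>r>0. \<exists>M. ball a r \<subseteq> U \<and>
        (\<forall>x\<in>ball a r. x - a \<in> coord_subspace UNIV \<longrightarrow> cmod (f x) \<le> M)"
      by (rule locally_bounded_coord[OF f \<open>open U\<close> finite_class.finite_UNIV a])
    then obtain r M where "0 < r" "ball a r \<subseteq> U"
      "\<And>x. x \<in> ball a r \<Longrightarrow> x - a \<in> coord_subspace UNIV \<Longrightarrow> cmod (f x) \<le> M"
      by metis
    then have "continuous (at a within {x. x - a \<in> coord_subspace UNIV}) f"
      by (intro continuous_within_if_bounded[OF f])
    then show ?thesis by (simp add: coord_subspace_def)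
  qed
  then show ?thesis by (simp add: continuous_at_imp_continuous_on)
qed

section \<open>Closure properties of holomorphic functions on a set\<close>

lemma mv_holomorphic_at_const: "mv_holomorphic_at (\<lambda>p. c) p"
  and mv_holomorphic_at_add: "mv_holomorphic_at f p \<Longrightarrow> mv_holomorphic_at g p \<Longrightarrow>
        mv_holomorphic_at (\<lambda>p. f p + g p) p"
  and mv_holomorphic_at_diff: "mv_holomorphic_at f p \<Longrightarrow> mv_holomorphic_at g p \<Longrightarrow>
        mv_holomorphic_at (\<lambda>p. f p - g p) p"
  and mv_holomorphic_at_mult: "mv_holomorphic_at f p \<Longrightarrow> mv_holomorphic_at g p \<Longrightarrow>
        mv_holomorphic_at (\<lambda>p. f p * g p) p"
  and mv_holomorphic_at_divide: "mv_holomorphic_at f p \<Longrightarrow> mv_holomorphic_at g p \<Longrightarrow>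
        g p \<noteq> 0 \<Longrightarrow> mv_holomorphic_at (\<lambda>p. f p / g p) p"
  unfolding mv_holomorphic_at_iff_line by (auto intro!: derivative_intros)

lemma holomorphic_in_const: "holomorphic_in (\<lambda>p. c) P"
  unfolding holomorphic_in_def using mv_holomorphic_at_const by blast

lemma holomorphic_in_common_domain:
  assumes "holomorphic_in f P" "holomorphic_in g P"
  obtains U f' g' where "open U" "P \<subseteq> U"
    "\<And>p. p \<in> U \<Longrightarrow> mv_holomorphic_at f' p" "\<And>p. p \<in> U \<Longrightarrow> mv_holomorphic_at g' p"
    "\<And>p. p \<in> P \<Longrightarrow> f' p = f p" "\<And>p. p \<in> P \<Longrightarrow> g' p = g p"
proof -
  obtain U f' where "open U" "P \<subseteq> U" "\<forall>p\<in>U. mv_holomorphic_at f' p" "\<forall>p\<in>P. f' p = f p"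
    using assms(1) by (auto simp: holomorphic_in_def)
  moreover obtain V g' where "open V" "P \<subseteq> V" "\<forall>p\<in>V. mv_holomorphic_at g' p" "\<forall>p\<in>P. g' p = g p"
    using assms(2) by (auto simp: holomorphic_in_def)
  ultimately show ?thesis
    by (intro that[of "U \<inter> V" f' g']) auto
qed

lemma holomorphic_in_add:
  assumes "holomorphic_in f P" "holomorphic_in g P"
  shows "holomorphic_in (\<lambda>p. f p + g p) P"
proof -
  obtain U f' g' where "open U" "P \<subseteq> U"
    "\<And>p. p \<in> U \<Longrightarrow> mv_holomorphic_at f' p" "\<And>p. p \<in> U \<Longrightarrow> mv_holomorphic_at g' p"
    "\<And>p. p \<in> P \<Longrightarrow> f' p = f p" "\<And>p. p \<in> P \<Longrightarrow> g' p = g p"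
    using holomorphic_in_common_domain[OF assms] by metis
  then show ?thesis unfolding holomorphic_in_def
    by (intro exI[of _ U] exI[of _ "\<lambda>p. f' p + g' p"]) (auto intro: mv_holomorphic_at_add)
qed

lemma holomorphic_in_diff:
  assumes "holomorphic_in f P" "holomorphic_in g P"
  shows "holomorphic_in (\<lambda>p. f p - g p) P"
proof -
  obtain U f' g' where "open U" "P \<subseteq> U"
    "\<And>p. p \<in> U \<Longrightarrow> mv_holomorphic_at f' p" "\<And>p. p \<in> U \<Longrightarrow> mv_holomorphic_at g' p"
    "\<And>p. p \<in> P \<Longrightarrow> f' p = f p" "\<And>p. p \<in> P \<Longrightarrow> g' p = g p"
    using holomorphic_in_common_domain[OF assms] by metis
  then show ?thesis unfolding holomorphic_in_def
    by (intro exI[of _ U] exI[of _ "\<lambda>p. f' p - g' p"]) (auto intro: mv_holomorphic_at_diff)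
qed

lemma holomorphic_in_mult:
  assumes "holomorphic_in f P" "holomorphic_in g P"
  shows "holomorphic_in (\<lambda>p. f p * g p) P"
proof -
  obtain U f' g' where "open U" "P \<subseteq> U"
    "\<And>p. p \<in> U \<Longrightarrow> mv_holomorphic_at f' p" "\<And>p. p \<in> U \<Longrightarrow> mv_holomorphic_at g' p"
    "\<And>p. p \<in> P \<Longrightarrow> f' p = f p" "\<And>p. p \<in> P \<Longrightarrow> g' p = g p"
    using holomorphic_in_common_domain[OF assms] by metis
  then show ?thesis unfolding holomorphic_in_def
    by (intro exI[of _ U] exI[of _ "\<lambda>p. f' p * g' p"]) (auto intro: mv_holomorphic_at_mult)
qed

text \<open>
  Continuity of the extension of the denominator is what makes the set of its nonzeros an open
  neighbourhood of \<open>P\<close>.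
\<close>

lemma holomorphic_in_divide:
  assumes "holomorphic_in f P" "holomorphic_in g P" and nz: "\<And>p. p \<in> P \<Longrightarrow> g p \<noteq> 0"
  shows "holomorphic_in (\<lambda>p. f p / g p) P"
proof -
  obtain U f' g' where U: "open U" "P \<subseteq> U"
    "\<And>p. p \<in> U \<Longrightarrow> mv_holomorphic_at f' p" "\<And>p. p \<in> U \<Longrightarrow> mv_holomorphic_at g' p"
    "\<And>p. p \<in> P \<Longrightarrow> f' p = f p" "\<And>p. p \<in> P \<Longrightarrow> g' p = g p"
    using holomorphic_in_common_domain[OF assms(1,2)] by metis
  have "continuous_on U g'"
    using U by (intro mv_holomorphic_imp_continuous_on)
  then have "open (U \<inter> g' -` (- {0}))"
    using \<open>open U\<close> by (intro continuous_open_preimage) auto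
  then show ?thesis unfolding holomorphic_in_def using U nz
    by (intro exI[of _ "U \<inter> g' -` (- {0})"] exI[of _ "\<lambda>p. f' p / g' p"])
      (auto intro: mv_holomorphic_at_divide)
qed

lemma holomorphic_in_sum:
  "(\<And>i. i \<in> I \<Longrightarrow> holomorphic_in (f i) P) \<Longrightarrow> holomorphic_in (\<lambda>p. \<Sum>i\<in>I. f i p) P"
  by (induction I rule: infinite_finite_induct) (auto intro: holomorphic_in_const holomorphic_in_add)

lemma holomorphic_in_prod:
  "(\<And>i. i \<in> I \<Longrightarrow> holomorphic_in (f i) P) \<Longrightarrow> holomorphic_in (\<lambda>p. \<Prod>i\<in>I. f i p) P"
  by (induction I rule: infinite_finite_induct) (auto intro: holomorphic_in_const holomorphic_in_mult)

lemma holomorphic_in_det: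
  "mat_holomorphic_in F P \<Longrightarrow> holomorphic_in (\<lambda>p. det (F p)) P"
  unfolding det_def mat_holomorphic_in_def
  by (intro holomorphic_in_sum holomorphic_in_mult holomorphic_in_const holomorphic_in_prod) auto

lemma mat_holomorphic_in_transpose:
  "mat_holomorphic_in F P \<Longrightarrow> mat_holomorphic_in (\<lambda>p. transpose (F p)) P"
  by (simp add: mat_holomorphic_in_def transpose_def)

lemma vec_holomorphic_in_matrix_vector_mult:
  "mat_holomorphic_in F P \<Longrightarrow> vec_holomorphic_in v P \<Longrightarrow> vec_holomorphic_in (\<lambda>p. F p *v v p) P"
  unfolding mat_holomorphic_in_def vec_holomorphic_in_def matrix_vector_mult_def
  by (auto intro!: holomorphic_in_sum holomorphic_in_mult)

section \<open>Linear systems with holomorphic coefficients\<close>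

lemma holomorphic_linear_solve:
  fixes K :: "complex^'nu \<Rightarrow> complex^'k^'k" and b :: "complex^'nu \<Rightarrow> complex^'k"
  assumes K: "mat_holomorphic_in K P" and b: "vec_holomorphic_in b P"
    and det: "\<And>p. p \<in> P \<Longrightarrow> det (K p) \<noteq> 0"
  shows "\<exists>x. vec_holomorphic_in x P \<and> (\<forall>p\<in>P. K p *v x p = b p)"
proof -
  \<comment> \<open>Cramer's rule\<close>
  define x where "x = (\<lambda>p. \<chi> k. det (\<chi> i j. if j = k then b p $ i else K p $ i $ j) / det (K p))"
  have "mat_holomorphic_in (\<lambda>p. \<chi> i j. if j = k then b p $ i else K p $ i $ j) P" for k
    unfolding mat_holomorphic_in_def
  proof (intro allI)
    fix i j
    show "holomorphic_in (\<lambda>p. (\<chi> i j. if j = k then b p $ i else K p $ i $ j) $ i $ j) P"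
      using K b by (cases "j = k") (auto simp: mat_holomorphic_in_def vec_holomorphic_in_def)
  qed
  then have "vec_holomorphic_in x P"
    using K det by (auto simp: x_def vec_holomorphic_in_def
        intro!: holomorphic_in_divide holomorphic_in_det)
  moreover have "K p *v x p = b p" if "p \<in> P" for p
    using cramer[OF det[OF that]] by (simp add: x_def)
  ultimately show ?thesis by blast
qed

lemma not_in_pencil_spectrum_imp_det_nonzero:
  fixes E A :: "complex^'k^'k"
  assumes "s \<notin> pencil_spectrum E A"
  shows "det (map_matrix (\<lambda>z. s * z) E - A) \<noteq> 0"
proof -
  let ?K = "map_matrix (\<lambda>z. s * z) E - A"
  have "vec.dim (rows ?K) \<ge> vec.dimension TYPE(complex) TYPE('k)"
    using assms by (simp add: pencil_spectrum_def row_rank_def_gen vec.dimension_def card_cart_basis)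
  then have "vec.span (rows ?K) = UNIV"
    using vec.dim_subset_UNIV[of "rows ?K"] vec.dim_eq_full by (metis le_antisym)
  then have "\<exists>B. B ** ?K = mat 1"
    by (simp add: matrix_left_invertible_span_rows_gen)
  then show ?thesis
    by (metis invertible_det_nz invertible_left_inverse)
qed

lemma matrix_mult_matrix_of_columns:
  "X ** matrix_of_columns c = matrix_of_columns (\<lambda>i. X *v c i)"
  by (simp add: vec_eq_iff matrix_of_columns_def matrix_matrix_mult_def matrix_vector_mult_def)

lemma matrix_of_columns_mult_diag_matrix:
  "matrix_of_columns c ** diag_matrix d = matrix_of_columns (\<lambda>i. d i *s c i)"
  by (simp add: vec_eq_iff matrix_of_columns_def matrix_matrix_mult_def diag_matrix_def
      if_distrib mult.commute cong: if_cong)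

text \<open>
  The equation for \<open>V\<close> is solved column by column. The equation for \<open>W\<close> is the instance with
  \<open>E\<close>, \<open>A\<close> and \<open>C\<close> replaced by their transposes; this is why nonsingularity is expressed by the
  determinant, which is invariant under transposition.
\<close>

lemma holomorphic_sylvester_solution:
  fixes E A :: "complex^'nu \<Rightarrow> complex^'N^'N"
    and B :: "complex^'nu \<Rightarrow> complex^'m^'N"
    and lam :: "'n::finite \<Rightarrow> complex^'nu \<Rightarrow> complex"
    and r :: "'n \<Rightarrow> complex^'nu \<Rightarrow> complex^'m"
  assumes E: "mat_holomorphic_in E P" and A: "mat_holomorphic_in A P"
    and B: "mat_holomorphic_in B P"
    and lam: "\<And>i. holomorphic_in (lam i) P" and r: "\<And>i. vec_holomorphic_in (r i) P"
    and det: "\<And>i p. p \<in> P \<Longrightarrow> det (map_matrix (\<lambda>z. lam i p * z) (E p) - A p) \<noteq> 0"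
  shows "\<exists>V :: complex^'nu \<Rightarrow> complex^'n^'N. mat_holomorphic_in V P \<and>
           (\<forall>p\<in>P. A p ** V p - E p ** V p ** diag_matrix (\<lambda>i. lam i p)
                    + B p ** matrix_of_columns (\<lambda>i. r i p) = 0)"
proof -
  have "\<exists>v. vec_holomorphic_in v P \<and>
          (\<forall>p\<in>P. (map_matrix (\<lambda>z. lam i p * z) (E p) - A p) *v v p = B p *v r i p)" for i
  proof (rule holomorphic_linear_solve)
    show "mat_holomorphic_in (\<lambda>p. map_matrix (\<lambda>z. lam i p * z) (E p) - A p) P"
      using E A lam by (auto simp: mat_holomorphic_in_def
          intro!: holomorphic_in_diff holomorphic_in_mult)
  qed (use B r det in \<open>auto intro: vec_holomorphic_in_matrix_vector_mult\<close>)
  then obtain v where v: "\<And>i. vec_holomorphic_in (v i) P"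
    and eq: "\<And>i p. p \<in> P \<Longrightarrow> (map_matrix (\<lambda>z. lam i p * z) (E p) - A p) *v v i p = B p *v r i p"
    by metis
  have "map_matrix (\<lambda>z. c * z) X *v y = c *s (X *v y)" for c and X :: "complex^'N^'N" and y
    by (simp add: vec_eq_iff matrix_vector_mult_def sum_distrib_left mult.assoc)
  then have col: "A p *v v i p - lam i p *s (E p *v v i p) + B p *v r i p = 0"
    if "p \<in> P" for i p
    using eq[OF that, of i] by (simp add: matrix_vector_mult_diff_rdistrib flip: eq[OF that])
  define V where "V = (\<lambda>p. matrix_of_columns (\<lambda>i. v i p))"
  have "mat_holomorphic_in V P"
    using v by (simp add: V_def mat_holomorphic_in_def vec_holomorphic_in_def matrix_of_columns_def)
  moreover have "A p ** V p - E p ** V p ** diag_matrix (\<lambda>i. lam i p)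
      + B p ** matrix_of_columns (\<lambda>i. r i p) = 0" if "p \<in> P" for p
  proof -
    have "A p ** V p - E p ** V p ** diag_matrix (\<lambda>i. lam i p) + B p ** matrix_of_columns (\<lambda>i. r i p)
        = matrix_of_columns (\<lambda>i. A p *v v i p - lam i p *s (E p *v v i p) + B p *v r i p)"
      unfolding V_def matrix_mult_matrix_of_columns matrix_of_columns_mult_diag_matrix
      by (simp add: matrix_of_columns_def vec_eq_iff)
    also have "\<dots> = 0" using col[OF that] by (simp add: matrix_of_columns_def vec_eq_iff)
    finally show ?thesis .
  qed
  ultimately show ?thesis by blast
qed

theorem theorem3p1:
  fixes P :: "(complex^'nu) set"
    and E A :: "complex^'nu \<Rightarrow> complex^'N^'N"
    and B :: "complex^'nu \<Rightarrow> complex^'m^'N"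
    and C :: "complex^'nu \<Rightarrow> complex^'N^'l"
    and lam mu :: "'n::finite \<Rightarrow> complex^'nu \<Rightarrow> complex"
    and r :: "'n \<Rightarrow> complex^'nu \<Rightarrow> complex^'m"
    and l :: "'n \<Rightarrow> complex^'nu \<Rightarrow> complex^'l"
    and Lambda M :: "complex^'nu \<Rightarrow> complex^'n^'n"
    and R :: "complex^'nu \<Rightarrow> complex^'n^'m"
    and L :: "complex^'nu \<Rightarrow> complex^'n^'l"
  defines "Lambda \<equiv> \<lambda>p. diag_matrix (\<lambda>i. lam i p)"
    and "M \<equiv> \<lambda>p. diag_matrix (\<lambda>i. mu i p)"
    and "R \<equiv> \<lambda>p. matrix_of_columns (\<lambda>i. r i p)"
    and "L \<equiv> \<lambda>p. matrix_of_columns (\<lambda>i. l i p)"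
  assumes "compact P"
    and "mat_holomorphic_in E P" and "mat_holomorphic_in A P"
    and "mat_holomorphic_in B P" and "mat_holomorphic_in C P"
    and "\<And>p. p \<in> P \<Longrightarrow> invertible (E p)"
    and "\<And>i. holomorphic_in (lam i) P" and "\<And>i. holomorphic_in (mu i) P"
    and "\<And>i p. p \<in> P \<Longrightarrow> lam i p \<notin> pencil_spectrum (E p) (A p)"
    and "\<And>i p. p \<in> P \<Longrightarrow> mu i p \<notin> pencil_spectrum (E p) (A p)"
    and "\<And>i. vec_holomorphic_in (r i) P" and "\<And>i. vec_holomorphic_in (l i) P"
  shows "\<exists>V W :: complex^'nu \<Rightarrow> complex^'n^'N.
           mat_holomorphic_in V P \<and> mat_holomorphic_in W P \<and>
           (\<forall>p\<in>P. A p ** V p - E p ** V p ** Lambda p + B p ** R p = 0 \<and>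
                  transpose (W p) ** A p - transpose (M p) ** transpose (W p) ** E p
                    + transpose (L p) ** C p = 0)"
proof -
  have "\<exists>V. mat_holomorphic_in V P \<and> (\<forall>p\<in>P. A p ** V p - E p ** V p ** Lambda p + B p ** R p = 0)"
    unfolding Lambda_def R_def using assms
    by (intro holomorphic_sylvester_solution not_in_pencil_spectrum_imp_det_nonzero) auto
  then obtain V where V: "mat_holomorphic_in V P"
    "\<And>p. p \<in> P \<Longrightarrow> A p ** V p - E p ** V p ** Lambda p + B p ** R p = 0"
    by blast
  \<comment> \<open>The transpose of the second equation has the form of the first one.\<close>
  have "\<exists>W. mat_holomorphic_in W P \<and> (\<forall>p\<in>P. transpose (A p) ** W p
          - transpose (E p) ** W p ** M p + transpose (C p) ** L p = 0)"
    unfolding M_def L_def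
  proof (rule holomorphic_sylvester_solution)
    fix i p assume "p \<in> P"
    then have "det (map_matrix (\<lambda>z. mu i p * z) (E p) - A p) \<noteq> 0"
      using assms by (intro not_in_pencil_spectrum_imp_det_nonzero) auto
    moreover have "map_matrix (\<lambda>z. mu i p * z) (transpose (E p)) - transpose (A p)
        = transpose (map_matrix (\<lambda>z. mu i p * z) (E p) - A p)"
      by (simp add: vec_eq_iff transpose_def)
    ultimately show "det (map_matrix (\<lambda>z. mu i p * z) (transpose (E p)) - transpose (A p)) \<noteq> 0"
      by (simp add: det_transpose)
  qed (use assms in \<open>auto intro: mat_holomorphic_in_transpose\<close>)
  then obtain W where W: "mat_holomorphic_in W P"
    "\<And>p. p \<in> P \<Longrightarrow> transpose (A p) ** W p - transpose (E p) ** W p ** M p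
        + transpose (C p) ** L p = 0"
    by blast
  have transpose_add: "transpose (X + Y) = transpose X + transpose Y"
    and transpose_diff: "transpose (X - Y) = transpose X - transpose Y"
    for X Y :: "complex^'n^'N"
    by (simp_all add: vec_eq_iff transpose_def)
  have "transpose (W p) ** A p - transpose (M p) ** transpose (W p) ** E p
          + transpose (L p) ** C p = 0" if "p \<in> P" for p
  proof -
    have "transpose (W p) ** A p - transpose (M p) ** transpose (W p) ** E p
            + transpose (L p) ** C p
        = transpose (transpose (A p) ** W p - transpose (E p) ** W p ** M p
            + transpose (C p) ** L p)"
      by (simp add: transpose_add transpose_diff matrix_transpose_mul matrix_mul_assoc)
    also have "\<dots> = 0"
      unfolding W(2)[OF that] by (simp add: vec_eq_iff transpose_def)
    finally show ?thesis .
  qed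
  with V W(1) show ?thesis by blast
qed

end
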